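(* Let $n\ge2$. Each $L_i$, $1\le i\le n$, has proper factorizations over $\mathfrak{L}_n$.
   Context: Let $\mathcal{F}_n$ be the unital free semigroup on $n$ generators $z_1,\dots,z_n$ (its unit is the empty word $1$), and let $\mathcal{H}_n=\ell_2(\mathcal{F}_n)$, with orthonormal basis $\{\xi_w: w\in\mathcal{F}_n\}$. Let $L_i$ be the isometry on $\mathcal{H}_n$ with $L_i\xi_v=\xi_{z_iv}$. The non-commutative analytic Toeplitz algebra $\mathfrak{L}_n$ is the unital algebra, closed in the weak operator topology, generated by $L_1,\dots,L_n$ in $\mathcal{B}(\mathcal{H}_n)$. An operator $L\in\mathfrak{L}_n$ has a proper factorization over $\mathfrak{L}_n$ if $L=BC$ for some $B,C\in\mathfrak{L}_n$, neither of which is invertible. *)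

theory Defs
  imports "HOL-Analysis.Analysis"
begin

section \<open>The complex Hilbert space of square-summable families\<close>

typedef 'a ell2 = "{f :: 'a \<Rightarrow> complex. (\<lambda>a. (cmod (f a))\<^sup>2) summable_on UNIV}"
  morphisms coord Abs_ell2
  by (rule exI[of _ "\<lambda>_. 0"]) simp

lemma coord_summable: "(\<lambda>a. (cmod (coord x a))\<^sup>2) summable_on UNIV"
  using coord[of x] by simp

lemma coord_Abs_ell2:
  "(\<lambda>a. (cmod (f a))\<^sup>2) summable_on UNIV \<Longrightarrow> coord (Abs_ell2 f) = f"
  by (simp add: Abs_ell2_inverse)

lemma ell2_eqI: "(\<And>a. coord x a = coord y a) \<Longrightarrow> x = y"
  by (metis coord_inject ext)

lemma ell2_add_summable:
  assumes "(\<lambda>a. (cmod (f a))\<^sup>2) summable_on UNIV" "(\<lambda>a. (cmod (g a))\<^sup>2) summable_on UNIV"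
  shows "(\<lambda>a. (cmod (f a + g a))\<^sup>2) summable_on UNIV"
proof (rule summable_on_comparison_test)
  show "(\<lambda>a. 2 * (cmod (f a))\<^sup>2 + 2 * (cmod (g a))\<^sup>2) summable_on UNIV"
    using assms by (intro summable_on_add summable_on_cmult_right)
  fix a
  have "(cmod (f a + g a))\<^sup>2 \<le> (cmod (f a) + cmod (g a))\<^sup>2"
    by (intro power_mono norm_triangle_ineq) auto
  also have "\<dots> \<le> 2 * (cmod (f a))\<^sup>2 + 2 * (cmod (g a))\<^sup>2"
    using sum_squares_bound[of "cmod (f a)" "cmod (g a)"] by (simp add: power2_sum)
  finally show "(cmod (f a + g a))\<^sup>2 \<le> 2 * (cmod (f a))\<^sup>2 + 2 * (cmod (g a))\<^sup>2" .
qed auto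

lemma ell2_scale_summable:
  assumes "(\<lambda>a. (cmod (f a))\<^sup>2) summable_on UNIV"
  shows "(\<lambda>a. (cmod (c * f a))\<^sup>2) summable_on UNIV"
  using summable_on_cmult_right[OF assms, of "(cmod c)\<^sup>2"]
  by (simp add: norm_mult power_mult_distrib)

lemma ell2_inner_abs_summable:
  assumes "(\<lambda>a. (cmod (f a))\<^sup>2) summable_on UNIV" "(\<lambda>a. (cmod (g a))\<^sup>2) summable_on UNIV"
  shows "(\<lambda>a. cmod (f a * cnj (g a))) summable_on UNIV"
proof (rule summable_on_comparison_test)
  show "(\<lambda>a. (cmod (f a))\<^sup>2 + (cmod (g a))\<^sup>2) summable_on UNIV"
    using assms by (intro summable_on_add)
  fix a
  show "cmod (f a * cnj (g a)) \<le> (cmod (f a))\<^sup>2 + (cmod (g a))\<^sup>2"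
  proof -
    have "0 \<le> cmod (f a) * cmod (g a)" by simp
    moreover have "2 * (cmod (f a) * cmod (g a)) \<le> (cmod (f a))\<^sup>2 + (cmod (g a))\<^sup>2"
      using sum_squares_bound[of "cmod (f a)" "cmod (g a)"] by (simp add: mult.assoc)
    ultimately show ?thesis unfolding norm_mult complex_mod_cnj by linarith
  qed
qed auto

definition scaleC :: "complex \<Rightarrow> 'a ell2 \<Rightarrow> 'a ell2" where
  "scaleC c x = Abs_ell2 (\<lambda>a. c * coord x a)"

lemma coord_scaleC [simp]: "coord (scaleC c x) a = c * coord x a"
  unfolding scaleC_def by (subst coord_Abs_ell2) (auto intro: ell2_scale_summable coord_summable)

definition cinner :: "'a ell2 \<Rightarrow> 'a ell2 \<Rightarrow> complex" where
  "cinner x y = (\<Sum>\<^sub>\<infinity>a. coord x a * cnj (coord y a))"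

lemma cinner_summable: "(\<lambda>a. coord x a * cnj (coord y a)) summable_on UNIV"
  by (rule abs_summable_summable, rule ell2_inner_abs_summable) (rule coord_summable)+

instantiation ell2 :: (type) real_inner
begin

definition "0 = Abs_ell2 (\<lambda>_. 0)"
definition "x + y = Abs_ell2 (\<lambda>a. coord x a + coord y a)"
definition "- x = scaleC (-1) (x :: 'a ell2)"
definition "x - y = x + - (y :: 'a ell2)"
definition "scaleR r x = scaleC (complex_of_real r) (x :: 'a ell2)"
definition "inner x y = Re (cinner x (y :: 'a ell2))"
definition "norm x = sqrt (inner x (x :: 'a ell2))"
definition "sgn x = scaleR (inverse (norm x)) (x :: 'a ell2)"
definition "dist x y = norm (x - (y :: 'a ell2))"
definition [code del]:
  "(uniformity :: ('a ell2 \<times> 'a ell2) filter) = (INF e\<in>{0<..}. principal {(x, y). dist x y < e})"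
definition [code del]:
  "open (U :: 'a ell2 set) = (\<forall>x\<in>U. eventually (\<lambda>(x', y). x' = x \<longrightarrow> y \<in> U) uniformity)"

lemma coord_zero [simp]: "coord (0 :: 'a ell2) a = 0"
  unfolding zero_ell2_def by (subst coord_Abs_ell2) auto

lemma coord_add [simp]: "coord (x + y) a = coord x a + coord (y :: 'a ell2) a"
  unfolding plus_ell2_def
  by (subst coord_Abs_ell2) (auto intro: ell2_add_summable coord_summable)

lemma coord_uminus [simp]: "coord (- x) a = - coord (x :: 'a ell2) a"
  by (simp add: uminus_ell2_def)

lemma coord_minus [simp]: "coord (x - y) a = coord x a - coord (y :: 'a ell2) a"
  by (simp add: minus_ell2_def)

lemma coord_scaleR [simp]: "coord (r *\<^sub>R x) a = r * coord (x :: 'a ell2) a"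
  by (simp add: scaleR_ell2_def)

lemma cinner_self: "cinner x (x :: 'a ell2) = of_real (\<Sum>\<^sub>\<infinity>a. (cmod (coord x a))\<^sup>2)"
proof -
  have "cinner x x = (\<Sum>\<^sub>\<infinity>a. complex_of_real ((cmod (coord x a))\<^sup>2))"
    unfolding cinner_def complex_norm_square ..
  also have "\<dots> = of_real (\<Sum>\<^sub>\<infinity>a. (cmod (coord x a))\<^sup>2)"
    using infsumI[OF has_sum_of_real[OF has_sum_infsum[OF coord_summable[of x]]]] by simp
  finally show ?thesis .
qed

lemma cinner_cnj: "cinner y (x :: 'a ell2) = cnj (cinner x y)"
  unfolding cinner_def by (simp flip: infsum_cnj add: mult.commute)

lemma cinner_add_left: "cinner (x + y) (z :: 'a ell2) = cinner x z + cinner y z"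
  unfolding cinner_def
  by (simp add: distrib_right infsum_add cinner_summable)

lemma cinner_scaleC_left: "cinner (scaleC c x) (y :: 'a ell2) = c * cinner x y"
  unfolding cinner_def by (simp add: mult.assoc infsum_cmult_right')

instance
proof
  fix x y z :: "'a ell2" and r s :: real
  show "x + y + z = x + (y + z)" "x + y = y + x" "0 + x = x" "- x + x = 0" "x - y = x + - y"
    "r *\<^sub>R (x + y) = r *\<^sub>R x + r *\<^sub>R y" "(r + s) *\<^sub>R x = r *\<^sub>R x + s *\<^sub>R x"
    "r *\<^sub>R s *\<^sub>R x = (r * s) *\<^sub>R x" "1 *\<^sub>R x = x"
    by (auto intro!: ell2_eqI simp: algebra_simps)
  show "dist x y = norm (x - y)" "sgn x = inverse (norm x) *\<^sub>R x" "norm x = sqrt (inner x x)"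
    by (simp_all add: dist_ell2_def sgn_ell2_def norm_ell2_def)
  show "(uniformity :: ('a ell2 \<times> 'a ell2) filter) = (INF e\<in>{0<..}. principal {(x, y). dist x y < e})"
    by (rule uniformity_ell2_def)
  show "open U = (\<forall>x\<in>U. eventually (\<lambda>(x', y). x' = x \<longrightarrow> y \<in> U) uniformity)" for U :: "'a ell2 set"
    by (rule open_ell2_def)
  show "inner x y = inner y x"
    unfolding inner_ell2_def by (subst cinner_cnj) simp
  show "inner (x + y) z = inner x z + inner y z"
    by (simp add: inner_ell2_def cinner_add_left)
  show "inner (r *\<^sub>R x) y = r * inner x y"
    by (simp add: inner_ell2_def scaleR_ell2_def cinner_scaleC_left)
  show "0 \<le> inner x x"
    by (simp add: inner_ell2_def cinner_self infsum_nonneg)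
  show "(inner x x = 0) = (x = 0)"
  proof
    assume "inner x x = 0"
    then have s: "(\<Sum>\<^sub>\<infinity>a. (cmod (coord x a))\<^sup>2) = 0"
      by (simp add: inner_ell2_def cinner_self)
    have "(cmod (coord x a))\<^sup>2 = 0" for a
      by (rule nonneg_infsum_le_0D[OF _ coord_summable[of x]]) (use s in auto)
    then show "x = 0" by (auto intro: ell2_eqI)
  qed (simp add: inner_ell2_def cinner_def)
qed

end

lemma norm_ell2_infsum: "norm (x :: 'a ell2) = sqrt (\<Sum>\<^sub>\<infinity>a. (cmod (coord x a))\<^sup>2)"
  by (simp add: norm_ell2_def inner_ell2_def cinner_self)

definition basis_vec :: "'a \<Rightarrow> 'a ell2" where
  "basis_vec b = Abs_ell2 (\<lambda>a. if a = b then 1 else 0)"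

lemma coord_basis_vec [simp]: "coord (basis_vec b) a = (if a = b then 1 else 0)"
proof -
  have "(\<lambda>a. (cmod (if a = b then 1 else 0))\<^sup>2) summable_on UNIV"
    using summable_on_finite[of "{b}" "\<lambda>_. 1 :: real"]
    by (rule summable_on_cong_neutral[THEN iffD1, rotated -1]) auto
  then show ?thesis unfolding basis_vec_def by (subst coord_Abs_ell2) auto
qed

section \<open>Bounded operators and the weak operator topology\<close>

text \<open>The library type of bounded linear maps only knows real scalars, so the algebra of bounded
  operators is the subset of the complex-linear ones.\<close>

definition bounded_ops :: "('a ell2 \<Rightarrow>\<^sub>L 'a ell2) set" where
  "bounded_ops = {T :: 'a ell2 \<Rightarrow>\<^sub>L 'a ell2. \<forall>c x. T (scaleC c x) = scaleC c (T x)}"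

definition weak_operator_topology :: "('a ell2 \<Rightarrow>\<^sub>L 'a ell2) topology" where
  "weak_operator_topology =
     pullback_topology bounded_ops (\<lambda>T (x, y). cinner (blinfun_apply T x) y) euclidean"

lemma bounded_linear_scaleC: "bounded_linear (scaleC c :: 'a ell2 \<Rightarrow> 'a ell2)"
proof (rule bounded_linear_intro[where K = "cmod c"])
  fix x y :: "'a ell2" and r :: real
  show "scaleC c (x + y) = scaleC c x + scaleC c y" "scaleC c (r *\<^sub>R x) = r *\<^sub>R scaleC c x"
    by (auto intro!: ell2_eqI simp: algebra_simps)
  show "norm (scaleC c x) \<le> norm x * cmod c"
    by (simp add: norm_ell2_infsum norm_mult power_mult_distrib infsum_cmult_right'
        real_sqrt_mult mult.commute)
qed

definition scalar_op :: "complex \<Rightarrow> 'a ell2 \<Rightarrow>\<^sub>L 'a ell2" where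
  "scalar_op c = Blinfun (scaleC c)"

lemma scalar_op_apply [simp]: "scalar_op c x = scaleC c x"
  by (simp add: scalar_op_def bounded_linear_Blinfun_apply bounded_linear_scaleC)

definition unital_subalgebra :: "('a ell2 \<Rightarrow>\<^sub>L 'a ell2) set \<Rightarrow> bool" where
  "unital_subalgebra A \<longleftrightarrow>
     A \<subseteq> bounded_ops \<and> id_blinfun \<in> A \<and>
     (\<forall>S\<in>A. \<forall>T\<in>A. S + T \<in> A) \<and>
     (\<forall>c. \<forall>T\<in>A. scalar_op c o\<^sub>L T \<in> A) \<and>
     (\<forall>S\<in>A. \<forall>T\<in>A. S o\<^sub>L T \<in> A)"

definition invertible_op :: "('a ell2 \<Rightarrow>\<^sub>L 'a ell2) \<Rightarrow> bool" where
  "invertible_op T \<longleftrightarrow> (\<exists>S\<in>bounded_ops. S o\<^sub>L T = id_blinfun \<and> T o\<^sub>L S = id_blinfun)"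

section \<open>The non-commutative analytic Toeplitz algebra\<close>

text \<open>The free semigroup on \<open>n\<close> generators is \<open>'n list\<close> with concatenation, where \<open>'n\<close> is a finite
  type with \<open>n\<close> elements; the full Fock space is \<open>'n list ell2\<close>.\<close>

definition creation_fun :: "'n \<Rightarrow> ('n list \<Rightarrow> complex) \<Rightarrow> 'n list \<Rightarrow> complex" where
  "creation_fun i f w = (case w of [] \<Rightarrow> 0 | j # v \<Rightarrow> if j = i then f v else 0)"

definition creation_op :: "'n \<Rightarrow> 'n list ell2 \<Rightarrow>\<^sub>L 'n list ell2" where
  "creation_op i = Blinfun (\<lambda>x. Abs_ell2 (creation_fun i (coord x)))"

lemma creation_fun_summable:
  fixes x :: "'n list ell2"
  shows "((\<lambda>w. (cmod (creation_fun i (coord x) w))\<^sup>2) has_sum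
          (\<Sum>\<^sub>\<infinity>v. (cmod (coord x v))\<^sup>2)) UNIV"
proof -
  have "((\<lambda>w. (cmod (creation_fun i (coord x) w))\<^sup>2) has_sum
          (\<Sum>\<^sub>\<infinity>v. (cmod (coord x v))\<^sup>2)) (range ((#) i))"
    by (subst has_sum_reindex)
      (auto simp: creation_fun_def o_def coord_summable intro!: has_sum_infsum inj_onI)
  then show ?thesis
    by (rule has_sum_cong_neutral[THEN iffD1, rotated -1])
      (auto simp: creation_fun_def split: list.splits)
qed

lemma creation_op_aux: "coord (Abs_ell2 (creation_fun i (coord x))) = creation_fun i (coord x)"
  by (rule coord_Abs_ell2, rule has_sum_imp_summable, rule creation_fun_summable)

lemma creation_op_norm_aux: "norm (Abs_ell2 (creation_fun i (coord x))) = norm x"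
  by (simp add: norm_ell2_infsum creation_op_aux infsumI[OF creation_fun_summable])

lemma coord_creation_op: "coord (creation_op i x) w = creation_fun i (coord x) w"
proof -
  have "bounded_linear (\<lambda>x. Abs_ell2 (creation_fun i (coord x)))"
    by (rule bounded_linear_intro[where K = 1])
      (auto intro!: ell2_eqI simp: creation_op_aux creation_op_norm_aux creation_fun_def
        split: list.splits)
  then show ?thesis
    by (simp add: creation_op_def bounded_linear_Blinfun_apply creation_op_aux)
qed

lemma norm_creation_op: "norm (creation_op i x) = norm x"
  by (simp add: norm_ell2_infsum coord_creation_op infsumI[OF creation_fun_summable])

lemma creation_op_basis_vec: "creation_op i (basis_vec v) = basis_vec (i # v)"
  by (auto intro!: ell2_eqI simp: coord_creation_op creation_fun_def split: list.splits)

definition toeplitz_algebra :: "('n::finite list ell2 \<Rightarrow>\<^sub>L 'n list ell2) set" where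
  "toeplitz_algebra =
     \<Inter> {A. unital_subalgebra A \<and> closedin weak_operator_topology A \<and> range creation_op \<subseteq> A}"

lemma toeplitz_algebra_subset_bounded_ops: "toeplitz_algebra \<subseteq> bounded_ops"
proof -
  have "unital_subalgebra bounded_ops"
    by (auto simp: unital_subalgebra_def bounded_ops_def plus_blinfun.rep_eq intro!: ell2_eqI
        simp: algebra_simps)
  moreover have "closedin weak_operator_topology bounded_ops"
    using closedin_topspace[of weak_operator_topology]
    by (simp add: weak_operator_topology_def topspace_pullback_topology)
  moreover have "range creation_op \<subseteq> bounded_ops"
    by (auto simp: bounded_ops_def coord_creation_op creation_fun_def intro!: ell2_eqI
        split: list.splits)
  ultimately show ?thesis unfolding toeplitz_algebra_def by blast
qed

text \<open>Invertibility is as an operator on the Fock space. Non-invertibility in this sense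
  implies non-invertibility within the algebra.\<close>

definition proper_factorization ::
  "('n::finite list ell2 \<Rightarrow>\<^sub>L 'n list ell2) \<Rightarrow> ('n list ell2 \<Rightarrow>\<^sub>L 'n list ell2) \<Rightarrow>
   ('n list ell2 \<Rightarrow>\<^sub>L 'n list ell2) \<Rightarrow> bool" where
  "proper_factorization L B C \<longleftrightarrow>
     B \<in> toeplitz_algebra \<and> C \<in> toeplitz_algebra \<and> L = B o\<^sub>L C \<and>
     \<not> invertible_op B \<and> \<not> invertible_op C"

end

theory Submission
  imports Defs
begin

text \<open>
  Fix a generator \<open>j\<close> other than \<open>i\<close> and look for a factorization \<open>L\<^sub>i = b(L\<^sub>j) (b\<^sup>-\<^sup>1(L\<^sub>j) L\<^sub>i)\<close>, where
  \<open>b\<close> is a power series in one variable with nonzero constant term. For the second factor to be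
  bounded, \<open>b\<^sup>-\<^sup>1(L\<^sub>j)\<close> itself need not be: the operators \<open>L\<^sub>j\<^sup>k L\<^sub>i\<close> are isometries with mutually
  orthogonal ranges, so \<open>\<Sum> a\<^sub>k L\<^sub>j\<^sup>k L\<^sub>i\<close> is bounded as soon as the \<open>a\<^sub>k\<close> are square summable. In one
  variable there is no room for this; it is where \<open>n \<ge> 2\<close> enters.

  The choice is \<open>b(z) = (1 - z)\<^bsup>1/4\<^esup>\<close>. By the asymptotics of binomial coefficients, those of
  \<open>(1 - z)\<^sup>\<alpha>\<close> are at most of order \<open>k\<^bsup>-\<alpha>-1\<^esup>\<close>. Hence \<open>b\<close> has summable coefficients and \<open>b\<^sup>-\<^sup>1\<close> has square summable
  ones, so both factors are bounded (\<open>fractional_power_operator\<close>,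
  \<open>square_summable_series_operator\<close>), and their product is \<open>L\<^sub>i\<close> by the Vandermonde convolution.

  The first factor is not invertible because \<open>b\<close> vanishes at \<open>1\<close>. For \<open>0 \<le> r < 1\<close> the vector
  \<open>\<Sum> r\<^sup>k \<xi>\<^bsub>w\<^esub>\<close>, summed over the words \<open>w = z\<^sub>j\<^sup>k\<close>, is an eigenvector of the adjoint of \<open>b(L\<^sub>j)\<close> with
  eigenvalue \<open>b(r)\<close>, and \<open>b(r)\<close> tends to \<open>0\<close> as \<open>r\<close> tends to \<open>1\<close>
  (\<open>not_invertible_of_adjoint_eigenvectors\<close>). The second factor is not invertible because its range
  misses the vacuum vector.

  Both series are handled as weak limits of their partial sums. Their partial sums are uniformly
  bounded, and each coordinate of the result is a finite sum, since words longer than \<open>w\<close> do not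
  contribute to the coordinate at \<open>w\<close>. A bounded sequence of operators that converges coordinatewise
  has a bounded limit and converges to it in the weak operator topology, so the limit stays in the
  Toeplitz algebra (\<open>word_series\<close>).
\<close>

section \<open>Weak limits of bounded sequences of operators\<close>

lemma sum_coord_le_norm:
  assumes "finite F"
  shows "(\<Sum>a\<in>F. (cmod (coord x a))\<^sup>2) \<le> (norm x)\<^sup>2"
proof -
  have "(norm x)\<^sup>2 = (\<Sum>\<^sub>\<infinity>a. (cmod (coord x a))\<^sup>2)"
    by (simp add: norm_ell2_infsum infsum_nonneg)
  then show ?thesis
    using finite_sum_le_infsum[OF coord_summable[of x] assms] by simp
qed

lemma ell2_of_bounded_sums:
  assumes "\<And>F. finite F \<Longrightarrow> (\<Sum>a\<in>F. (cmod (f a))\<^sup>2) \<le> K\<^sup>2" and "0 \<le> K"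
  obtains u where "coord u = f" and "norm u \<le> K"
proof -
  have s: "(\<lambda>a. (cmod (f a))\<^sup>2) summable_on UNIV"
    using assms(1) by (intro nonneg_bdd_above_summable_on) (auto simp: bdd_above_def)
  have c: "coord (Abs_ell2 f) = f"
    by (rule coord_Abs_ell2[OF s])
  moreover have "norm (Abs_ell2 f) \<le> K"
    unfolding norm_ell2_infsum c using infsum_le_finite_sums[OF s, of "K\<^sup>2"] assms
    by (intro real_le_lsqrt) (auto simp: infsum_nonneg)
  ultimately show thesis by (rule that)
qed

text \<open>
  Finite sums of squared coordinates pass to the limit, so the uniform bound on the operators both
  places the coordinatewise limit of \<open>p N x\<close> in the Hilbert space and bounds its norm. Working with
  coordinates avoids any appeal to completeness of the space of operators.
\<close>

lemma bounded_coordinatewise_limit: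
  fixes p :: "nat \<Rightarrow> 'a ell2 \<Rightarrow>\<^sub>L 'b ell2"
  assumes bound: "\<And>N. norm (p N) \<le> M"
    and conv: "\<And>x a. convergent (\<lambda>N. coord (p N x) a)"
  obtains P where "\<And>x a. (\<lambda>N. coord (p N x) a) \<longlonglongrightarrow> coord (blinfun_apply P x) a"
proof -
  define f where "f x a = lim (\<lambda>N. coord (p N x) a)" for x a
  have f: "(\<lambda>N. coord (p N x) a) \<longlonglongrightarrow> f x a" for x a
    using conv[of x a] unfolding f_def by (simp add: convergent_LIMSEQ_iff)
  have M: "0 \<le> M"
    using bound[of 0] norm_ge_zero[of "p 0"] by linarith
  have "\<exists>u. coord u = f x \<and> norm u \<le> M * norm x" for x
  proof -
    have "(\<Sum>a\<in>F. (cmod (f x a))\<^sup>2) \<le> (M * norm x)\<^sup>2" if "finite F" for F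
    proof (rule LIMSEQ_le_const2)
      show "(\<lambda>N. \<Sum>a\<in>F. (cmod (coord (p N x) a))\<^sup>2) \<longlonglongrightarrow> (\<Sum>a\<in>F. (cmod (f x a))\<^sup>2)"
        by (intro tendsto_intros f)
      have "(\<Sum>a\<in>F. (cmod (coord (p N x) a))\<^sup>2) \<le> (M * norm x)\<^sup>2" for N
      proof -
        have "norm (p N x) \<le> M * norm x"
          using norm_blinfun[of "p N" x] mult_right_mono[OF bound[of N], of "norm x"] by simp
        then have "(norm (p N x))\<^sup>2 \<le> (M * norm x)\<^sup>2"
          by (intro power_mono) auto
        then show ?thesis using sum_coord_le_norm[OF that, of "p N x"] by linarith
      qed
      then show "\<exists>N. \<forall>n\<ge>N. (\<Sum>a\<in>F. (cmod (coord (p n x) a))\<^sup>2) \<le> (M * norm x)\<^sup>2"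
        by blast
    qed
    then show ?thesis
      using ell2_of_bounded_sums[of "f x" "M * norm x"] M by auto
  qed
  then obtain T where T: "\<And>x. coord (T x) = f x" and T_norm: "\<And>x. norm (T x) \<le> M * norm x"
    by metis
  have "bounded_linear T"
  proof (rule bounded_linear_intro[where K = M])
    fix x y :: "'a ell2" and r :: real
    have "f (x + y) a = f x a + f y a" for a
      by (rule LIMSEQ_unique[OF f])
        (use tendsto_add[OF f[of x a] f[of y a]] in \<open>simp add: blinfun.add_right\<close>)
    then show "T (x + y) = T x + T y"
      by (auto intro!: ell2_eqI simp: T)
    have "f (r *\<^sub>R x) a = r * f x a" for a
      by (rule LIMSEQ_unique[OF f])
        (use tendsto_mult_left[OF f[of x a], of "of_real r"] in \<open>simp add: blinfun.scaleR_right\<close>)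
    then show "T (r *\<^sub>R x) = r *\<^sub>R T x"
      by (auto intro!: ell2_eqI simp: T)
  qed (simp add: T_norm mult.commute)
  then show thesis
    by (intro that[of "Blinfun T"]) (simp add: bounded_linear_Blinfun_apply T f)
qed

lemma cinner_diff_left: "cinner (x - y) z = cinner x z - cinner y z"
  using cinner_add_left[of "x - y" y z] by simp

lemma cinner_diff_right: "cinner x (y - z) = cinner x y - cinner x z"
  by (subst (1 2 3) cinner_cnj) (simp add: cinner_diff_left)

lemma norm_scaleC: "norm (scaleC c x) = cmod c * norm x"
  by (simp add: norm_ell2_infsum norm_mult power_mult_distrib infsum_cmult_right' real_sqrt_mult)

text \<open>
  The complex inequality follows from the real one after rotating \<open>x\<close> by a unimodular scalar that
  makes the inner product a nonnegative real number.
\<close>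

lemma cinner_Cauchy_Schwarz: "cmod (cinner x y) \<le> norm x * norm y"
proof (cases "cinner x y = 0")
  case False
  define c where "c = cnj (sgn (cinner x y))"
  have c: "cmod c = 1"
    using False by (simp add: c_def norm_sgn)
  have "cinner (scaleC c x) y = of_real (cmod (cinner x y))"
    using False
    by (simp add: cinner_scaleC_left c_def sgn_eq complex_norm_square[symmetric] power2_eq_square
        mult.commute)
  then have "cmod (cinner x y) = inner (scaleC c x) y"
    by (simp add: inner_ell2_def)
  also have "\<dots> \<le> norm x * norm y"
    using norm_cauchy_schwarz[of "scaleC c x" y] by (simp add: norm_scaleC c)
  finally show ?thesis .
qed simp

lemma finitely_supported_approx:
  fixes y :: "'a ell2"
  assumes "0 < e"
  obtains F z where "finite F" "\<And>a. a \<notin> F \<Longrightarrow> coord z a = 0" "norm (y - z) < e"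
proof -
  let ?s = "\<lambda>a. (cmod (coord y a))\<^sup>2"
  obtain F where F: "finite F" "dist (sum ?s F) (infsum ?s UNIV) \<le> (e / 2)\<^sup>2"
    using has_sum_finite_approximation[OF has_sum_infsum[OF coord_summable[of y]], of "(e / 2)\<^sup>2"]
      assms by auto
  define g where "g a = (if a \<in> F then coord y a else 0)" for a
  have "(\<Sum>a\<in>G. (cmod (g a))\<^sup>2) \<le> (norm y)\<^sup>2" if "finite G" for G
    using sum_coord_le_norm[OF that, of y]
    by (rule order_trans[rotated]) (auto intro!: sum_mono simp: g_def)
  then obtain z where z: "coord z = g"
    using ell2_of_bounded_sums[of g "norm y"] by auto
  have "(norm (y - z))\<^sup>2 = (\<Sum>\<^sub>\<infinity>a. (cmod (coord (y - z) a))\<^sup>2)"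
    by (simp add: norm_ell2_infsum infsum_nonneg)
  also have "\<dots> = infsum ?s (UNIV - F)"
    by (rule infsum_cong_neutral) (auto simp: z g_def)
  also have "\<dots> = infsum ?s UNIV - sum ?s F"
    using infsum_Diff[OF coord_summable[of y] summable_on_finite[OF F(1)]] F(1) by simp
  also have "\<dots> \<le> (e / 2)\<^sup>2"
    using F(2) by (simp add: dist_real_def)
  finally have "norm (y - z) \<le> e / 2"
    by (rule power2_le_imp_le) (use assms in simp)
  then show thesis
    using assms F(1) by (intro that[of F z]) (auto simp: z g_def)
qed

lemma cinner_finite_support:
  assumes "finite F" "\<And>a. a \<notin> F \<Longrightarrow> coord z a = 0"
  shows "cinner u z = (\<Sum>a\<in>F. coord u a * cnj (coord z a))"
proof -
  have "cinner u z = infsum (\<lambda>a. coord u a * cnj (coord z a)) F"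
    unfolding cinner_def by (rule infsum_cong_neutral) (auto simp: assms)
  then show ?thesis using assms(1) by simp
qed

text \<open>
  Against a finitely supported vector the claim is a finite sum of coordinate limits; the bound on
  the sequence controls the error of replacing \<open>y\<close> by such a vector.
\<close>

lemma weak_convergence_of_bounded_coordinatewise:
  assumes bound: "\<And>N. norm (u N) \<le> K"
    and conv: "\<And>a. (\<lambda>N. coord (u N) a) \<longlonglongrightarrow> coord v a"
  shows "(\<lambda>N. cinner (u N) y) \<longlonglongrightarrow> cinner v y"
proof (rule LIMSEQ_I)
  fix e :: real
  assume e: "0 < e"
  \<comment> \<open>\<open>D\<close> bounds the norm of \<open>u N - v\<close>; adding 1 makes it positive.\<close>
  define D where "D = K + norm v + 1"
  have D: "0 < D"
    using order_trans[OF norm_ge_zero bound[of 0]] by (simp add: D_def add_nonneg_pos)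
  obtain F z where F: "finite F" "\<And>a. a \<notin> F \<Longrightarrow> coord z a = 0" and z: "norm (y - z) < e / (2 * D)"
    using finitely_supported_approx[of "e / (2 * D)" y] e D by auto
  have "(\<lambda>N. cinner (u N) z) \<longlonglongrightarrow> cinner v z"
    by (simp add: cinner_finite_support[of F z, OF F] conv tendsto_sum tendsto_mult_right)
  from LIMSEQ_D[OF this half_gt_zero[OF e]]
  obtain N0 where N0: "\<And>N. N \<ge> N0 \<Longrightarrow> norm (cinner (u N) z - cinner v z) < e / 2"
    by blast
  have "norm (cinner (u N) y - cinner v y) < e" if "N \<ge> N0" for N
  proof -
    have "cinner (u N) y - cinner v y
        = cinner (u N - v) (y - z) + (cinner (u N) z - cinner v z)"
      by (simp add: cinner_diff_left cinner_diff_right)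
    then have "norm (cinner (u N) y - cinner v y)
        \<le> norm (cinner (u N - v) (y - z)) + norm (cinner (u N) z - cinner v z)"
      by (metis norm_triangle_ineq)
    moreover have "norm (cinner (u N - v) (y - z)) \<le> D * (e / (2 * D))"
    proof (rule order_trans[OF cinner_Cauchy_Schwarz], rule mult_mono)
      show "norm (u N - v) \<le> D"
        using norm_triangle_ineq4[of "u N" v] bound[of N] by (simp add: D_def)
    qed (use z D in auto)
    ultimately show ?thesis using N0[OF that] D by simp
  qed
  then show "\<exists>N0. \<forall>N\<ge>N0. norm (cinner (u N) y - cinner v y) < e" by blast
qed

text \<open>
  In the topology pulled back from the product topology, convergence of a sequence means
  convergence of every matrix coefficient.
\<close>

lemma closedin_weak_operator_topology_limit:
  assumes A: "closedin weak_operator_topology A"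
    and p: "\<And>N. p N \<in> A" and P: "P \<in> bounded_ops"
    and conv: "\<And>x y. (\<lambda>N. cinner (blinfun_apply (p N) x) y) \<longlonglongrightarrow> cinner (blinfun_apply P x) y"
  shows "P \<in> A"
proof (rule ccontr)
  assume "P \<notin> A"
  let ?f = "\<lambda>T (x, y). cinner (blinfun_apply T x) y"
  have top: "topspace weak_operator_topology = bounded_ops"
    by (simp add: weak_operator_topology_def topspace_pullback_topology)
  then have "openin weak_operator_topology (bounded_ops - A)"
    using A by (metis closedin_def)
  then obtain U where U: "open U" "bounded_ops - A = ?f -` U \<inter> bounded_ops"
    unfolding weak_operator_topology_def openin_pullback_topology by auto
  have "limitin euclidean (\<lambda>N. ?f (p N)) (?f P) sequentially"
    unfolding euclidean_product_topology[symmetric] limitin_componentwise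
    using conv by (auto simp: extensional_def)
  moreover have "?f P \<in> U"
    using U(2) P \<open>P \<notin> A\<close> by blast
  ultimately have "\<forall>\<^sub>F N in sequentially. ?f (p N) \<in> U"
    using U(1) by (auto simp: tendsto_def)
  then obtain N where "?f (p N) \<in> U"
    using eventually_happens'[OF sequentially_bot] by blast
  moreover have "p N \<in> bounded_ops"
    using A p[of N] top closedin_subset by blast
  ultimately show False
    using U(2) p[of N] by blast
qed

section \<open>Operators attached to words\<close>

lemma toeplitz_algebra_id: "id_blinfun \<in> toeplitz_algebra"
  and toeplitz_algebra_creation_op: "creation_op i \<in> toeplitz_algebra"
  and toeplitz_algebra_add: "S \<in> toeplitz_algebra \<Longrightarrow> T \<in> toeplitz_algebra \<Longrightarrow> S + T \<in> toeplitz_algebra"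
  and toeplitz_algebra_compose:
    "S \<in> toeplitz_algebra \<Longrightarrow> T \<in> toeplitz_algebra \<Longrightarrow> S o\<^sub>L T \<in> toeplitz_algebra"
  and toeplitz_algebra_scalar_op: "T \<in> toeplitz_algebra \<Longrightarrow> scalar_op c o\<^sub>L T \<in> toeplitz_algebra"
  by (auto simp: toeplitz_algebra_def unital_subalgebra_def)

lemma toeplitz_algebra_scaleR: "T \<in> toeplitz_algebra \<Longrightarrow> r *\<^sub>R T \<in> toeplitz_algebra"
proof -
  have "r *\<^sub>R T = scalar_op (of_real r) o\<^sub>L T"
    by (rule blinfun_eqI) (simp add: blinfun.scaleR_left scaleR_ell2_def)
  then show "T \<in> toeplitz_algebra \<Longrightarrow> r *\<^sub>R T \<in> toeplitz_algebra"
    by (simp add: toeplitz_algebra_scalar_op)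
qed

lemma toeplitz_algebra_sum:
  fixes f :: "'b \<Rightarrow> 'n::finite list ell2 \<Rightarrow>\<^sub>L 'n list ell2"
  assumes "\<And>k. k \<in> I \<Longrightarrow> f k \<in> toeplitz_algebra"
  shows "sum f I \<in> toeplitz_algebra"
proof -
  have "(0 :: 'n list ell2 \<Rightarrow>\<^sub>L 'n list ell2) \<in> toeplitz_algebra"
    using toeplitz_algebra_scaleR[OF toeplitz_algebra_id, of 0] by simp
  then show ?thesis
    using assms by (induction I rule: infinite_finite_induct) (auto intro: toeplitz_algebra_add)
qed

lemma toeplitz_algebra_limit:
  fixes p :: "nat \<Rightarrow> 'n::finite list ell2 \<Rightarrow>\<^sub>L 'n list ell2"
  assumes "\<And>N. p N \<in> toeplitz_algebra" and "P \<in> bounded_ops"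
    and "\<And>x y. (\<lambda>N. cinner (blinfun_apply (p N) x) y) \<longlonglongrightarrow> cinner (blinfun_apply P x) y"
  shows "P \<in> toeplitz_algebra"
  unfolding toeplitz_algebra_def
proof (rule InterI)
  fix A :: "('n list ell2 \<Rightarrow>\<^sub>L 'n list ell2) set"
  assume A: "A \<in> {A. unital_subalgebra A \<and> closedin weak_operator_topology A \<and> range creation_op \<subseteq> A}"
  have p: "p N \<in> A" for N
    by (rule InterD[OF assms(1)[of N, unfolded toeplitz_algebra_def] A])
  have "closedin weak_operator_topology A"
    using A by blast
  then show "P \<in> A"
    by (rule closedin_weak_operator_topology_limit[OF _ p assms(2,3)])
qed

primrec word_op :: "'n list \<Rightarrow> 'n list ell2 \<Rightarrow>\<^sub>L 'n list ell2" where
  "word_op [] = id_blinfun"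
| "word_op (j # v) = creation_op j o\<^sub>L word_op v"

lemma word_op_append: "word_op (u @ v) x = word_op u (word_op v x)"
  by (induction u) auto

text \<open>
  \<open>word_op v\<close> prepends \<open>v\<close> to every word. Hence a coordinate of the image at \<open>w\<close> is a coordinate of
  the argument at what remains of \<open>w\<close> after its prefix \<open>v\<close>; this turns all later computations into
  finite sums.
\<close>

lemma coord_word_op:
  "coord (word_op v x) w = (if take (length v) w = v then coord x (drop (length v) w) else 0)"
proof (induction v arbitrary: w)
  case (Cons j v)
  then show ?case by (cases w) (auto simp: coord_creation_op creation_fun_def)
qed simp

lemma coord_word_op_short: "length w < length v \<Longrightarrow> coord (word_op v x) w = 0"
  by (auto simp: coord_word_op dest: arg_cong[of _ _ length])

lemma norm_word_op_apply: "norm (word_op v x) = norm x"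
  by (induction v) (simp_all add: norm_creation_op)

lemma norm_word_op: "norm (word_op v) \<le> 1"
  by (rule norm_blinfun_bound) (simp_all add: norm_word_op_apply)

lemma word_op_in_toeplitz_algebra: "word_op v \<in> toeplitz_algebra"
  by (induction v)
    (auto intro: toeplitz_algebra_id toeplitz_algebra_compose toeplitz_algebra_creation_op)

lemma word_op_scaleC: "word_op v (scaleC c x) = scaleC c (word_op v (x :: 'n::finite list ell2))"
  using word_op_in_toeplitz_algebra[of v] toeplitz_algebra_subset_bounded_ops
  by (auto simp: bounded_ops_def)

text \<open>
  A word in the supports of both images would have both \<open>u\<close> and \<open>v\<close> as prefixes, and then the
  shorter of the two would be a prefix of the longer.
\<close>

lemma orthogonal_word_op:
  assumes "take (length u) v \<noteq> u" and "length u \<le> length v"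
  shows "orthogonal (word_op u x) (word_op v y)"
proof -
  have "coord (word_op u x) w * cnj (coord (word_op v y) w) = 0" for w
  proof (rule ccontr)
    assume "coord (word_op u x) w * cnj (coord (word_op v y) w) \<noteq> 0"
    then have "take (length u) w = u" "take (length v) w = v"
      by (auto simp: coord_word_op split: if_splits)
    then have "take (length u) v = u"
      using assms(2) by (metis min.absorb1 take_take)
    then show False using assms(1) by simp
  qed
  then have "cinner (word_op u x) (word_op v y) = 0"
    unfolding cinner_def by (intro infsum_0)
  then show ?thesis
    by (simp add: orthogonal_def inner_ell2_def)
qed

lemma coord_sum: "coord (sum f I) a = (\<Sum>k\<in>I. coord (f k) a)"
  by (induction I rule: infinite_finite_induct) auto

lemma coord_word_sum:
  "coord ((\<Sum>k\<in>I. c k *\<^sub>R word_op (v k)) x) w = (\<Sum>k\<in>I. of_real (c k) * coord (word_op (v k) x) w)"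
  by (simp add: blinfun.sum_left blinfun.scaleR_left coord_sum)

text \<open>
  The condition \<open>k \<le> length (v k)\<close> makes the coordinate at \<open>w\<close> of the partial sums constant as soon
  as they have more than \<open>length w\<close> terms. This gives the coordinatewise convergence, and with it the
  explicit finite formula for the sum of the series.
\<close>

lemma word_series:
  fixes v :: "nat \<Rightarrow> 'n::finite list" and c :: "nat \<Rightarrow> real"
  defines "p \<equiv> \<lambda>N. \<Sum>k<N. c k *\<^sub>R word_op (v k)"
  assumes bound: "\<And>N. norm (p N) \<le> M" and len: "\<And>k. k \<le> length (v k)"
  obtains P where "P \<in> toeplitz_algebra"
    and "\<And>x w N. length w < N \<Longrightarrow>
      coord (blinfun_apply P x) w = (\<Sum>k<N. of_real (c k) * coord (word_op (v k) x) w)"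
    and "\<And>x y. (\<lambda>N. cinner (p N x) y) \<longlonglongrightarrow> cinner (blinfun_apply P x) y"
proof -
  define s where "s x w N = (\<Sum>k<N. of_real (c k) * coord (word_op (v k) x) w)" for x w N
  have p: "coord (p N x) w = s x w N" for N x w
    by (simp add: p_def coord_word_sum s_def)
  have s: "s x w N = s x w (Suc (length w))" if "length w < N" for x w N
    unfolding s_def using that
    by (intro sum.mono_neutral_right) (auto intro!: coord_word_op_short less_le_trans[OF _ len])
  have lim: "s x w \<longlonglongrightarrow> s x w (Suc (length w))" for x w
    by (rule tendsto_eventually, rule eventually_sequentiallyI[of "Suc (length w)"]) (auto intro: s)
  obtain P where P: "\<And>x w. (\<lambda>N. coord (p N x) w) \<longlonglongrightarrow> coord (blinfun_apply P x) w"
    using bounded_coordinatewise_limit[of p M] bound lim unfolding p convergent_def by blast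
  have coord_P: "coord (blinfun_apply P x) w = s x w (Suc (length w))" for x w
    by (rule LIMSEQ_unique[OF P]) (simp only: p lim)
  have weak: "(\<lambda>N. cinner (p N x) y) \<longlonglongrightarrow> cinner (blinfun_apply P x) y" for x y
  proof (rule weak_convergence_of_bounded_coordinatewise)
    show "norm (p N x) \<le> M * norm x" for N
      using norm_blinfun[of "p N" x] mult_right_mono[OF bound[of N], of "norm x"] by simp
  qed (rule P)
  have P_bounded: "P \<in> bounded_ops"
    unfolding bounded_ops_def
    by (auto intro!: ell2_eqI simp: coord_P s_def word_op_scaleC sum_distrib_left mult.left_commute
        simp del: sum.lessThan_Suc)
  have p_toeplitz: "p N \<in> toeplitz_algebra" for N
    unfolding p_def
    by (intro toeplitz_algebra_sum toeplitz_algebra_scaleR word_op_in_toeplitz_algebra)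
  show thesis
  proof (rule that[OF _ _ weak])
    show "P \<in> toeplitz_algebra"
      by (rule toeplitz_algebra_limit[OF p_toeplitz P_bounded weak])
    show "coord (blinfun_apply P x) w = (\<Sum>k<N. of_real (c k) * coord (word_op (v k) x) w)"
      if "length w < N" for x w N
      using s[OF that, of x] coord_P[of x w] by (simp add: s_def)
  qed
qed

lemma norm_word_sum_le_l1:
  "norm (\<Sum>k\<in>I. c k *\<^sub>R word_op (v k)) \<le> (\<Sum>k\<in>I. \<bar>c k\<bar>)"
proof (rule order_trans[OF norm_sum], rule sum_mono)
  show "norm (c k *\<^sub>R word_op (v k)) \<le> \<bar>c k\<bar>" for k
    using mult_left_mono[OF norm_word_op[of "v k"], of "\<bar>c k\<bar>"] by simp
qed

text \<open>
  For pairwise prefix-incomparable words the word operators have orthogonal ranges, so the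
  Pythagorean theorem replaces the triangle inequality.
\<close>

lemma norm_word_sum_le_l2:
  assumes "finite I"
    and incomparable: "\<And>k m. k \<in> I \<Longrightarrow> m \<in> I \<Longrightarrow> k \<noteq> m \<Longrightarrow> take (length (v k)) (v m) \<noteq> v k"
  shows "norm (\<Sum>k\<in>I. c k *\<^sub>R word_op (v k)) \<le> sqrt (\<Sum>k\<in>I. (c k)\<^sup>2)"
proof (rule norm_blinfun_bound)
  fix x
  have "orthogonal (c k *\<^sub>R word_op (v k) x) (c m *\<^sub>R word_op (v m) x)"
    if "k \<in> I" "m \<in> I" "k \<noteq> m" for k m
  proof (cases "length (v k) \<le> length (v m)")
    case True
    then show ?thesis
      using incomparable[OF that] orthogonal_word_op[of "v k" "v m" x x]
      by (simp add: orthogonal_clauses)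
  next
    case False
    then show ?thesis
      using incomparable[OF that(2,1)] that(3) orthogonal_word_op[of "v m" "v k" x x]
      by (simp add: orthogonal_clauses orthogonal_commute)
  qed
  then have "(norm (\<Sum>k\<in>I. c k *\<^sub>R word_op (v k) x))\<^sup>2 = (\<Sum>k\<in>I. (norm (c k *\<^sub>R word_op (v k) x))\<^sup>2)"
    using assms(1) by (intro norm_sum_Pythagorean) (auto simp: pairwise_def)
  also have "\<dots> = (sqrt (\<Sum>k\<in>I. (c k)\<^sup>2) * norm x)\<^sup>2"
    by (simp add: norm_word_op_apply power_mult_distrib sum_distrib_right sum_nonneg)
  finally have "norm (\<Sum>k\<in>I. c k *\<^sub>R word_op (v k) x) = sqrt (\<Sum>k\<in>I. (c k)\<^sup>2) * norm x"
    by (rule power2_eq_imp_eq) (auto simp: sum_nonneg)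
  then show "norm ((\<Sum>k\<in>I. c k *\<^sub>R word_op (v k)) x) \<le> sqrt (\<Sum>k\<in>I. (c k)\<^sup>2) * norm x"
    by (simp add: blinfun.sum_left blinfun.scaleR_left)
qed (simp add: sum_nonneg)

section \<open>Adjoint eigenvectors\<close>

text \<open>
  The equation says that \<open>e\<close> is an eigenvector of the adjoint of \<open>T\<close>. If \<open>T S = id\<close>, then
  \<open>\<langle>e, e\<rangle> = \<langle>T S e, e\<rangle> = \<mu> \<langle>S e, e\<rangle>\<close>, so the modulus of \<open>\<mu>\<close> is at least the inverse of the norm of \<open>S\<close>.
\<close>

lemma not_invertible_of_adjoint_eigenvectors:
  fixes T :: "'a ell2 \<Rightarrow>\<^sub>L 'a ell2"
  assumes "\<And>\<epsilon>. 0 < \<epsilon> \<Longrightarrow>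
    \<exists>e \<mu>. e \<noteq> 0 \<and> cmod \<mu> < \<epsilon> \<and> (\<forall>x. cinner (T x) e = \<mu> * cinner x e)"
  shows "\<not> invertible_op T"
proof
  assume "invertible_op T"
  then obtain S where "T o\<^sub>L S = id_blinfun"
    unfolding invertible_op_def by blast
  then have TS: "T (S x) = x" for x
    by (metis blinfun_apply_blinfun_compose blinfun_apply_id_blinfun id_apply)
  define K where "K = norm S + 1"
  have K: "0 < K" by (simp add: K_def add_nonneg_pos)
  obtain e \<mu> where e: "e \<noteq> 0" "cmod \<mu> < 1 / K" "\<And>x. cinner (T x) e = \<mu> * cinner x e"
    using assms[of "1 / K"] K by auto
  have "(norm e)\<^sup>2 = cmod (cinner e e)"
    by (simp add: cinner_self norm_ell2_infsum infsum_nonneg)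
  also have "\<dots> = cmod \<mu> * cmod (cinner (S e) e)"
    using e(3)[of "S e"] by (simp add: TS norm_mult)
  also have "\<dots> \<le> cmod \<mu> * (norm (S e) * norm e)"
    by (intro mult_left_mono cinner_Cauchy_Schwarz) auto
  also have "\<dots> \<le> cmod \<mu> * (K * norm e * norm e)"
    using norm_blinfun[of S e]
    by (intro mult_left_mono mult_right_mono) (auto simp: K_def distrib_right add_increasing2)
  also have "\<dots> = (cmod \<mu> * K) * (norm e)\<^sup>2"
    by (simp add: power2_eq_square)
  also have "\<dots> < 1 * (norm e)\<^sup>2"
    using e(1,2) K by (intro mult_strict_right_mono) (auto simp: field_simps)
  finally show False by simp
qed

lemma cinner_creation_op_eigenvector:
  assumes "\<And>w. coord e (j # w) = of_real r * coord e w"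
  shows "cinner (creation_op j x) e = of_real r * cinner x e"
proof -
  have "cinner (creation_op j x) e
      = infsum (\<lambda>w. coord (creation_op j x) w * cnj (coord e w)) (range ((#) j))"
    unfolding cinner_def
    by (rule infsum_cong_neutral) (auto simp: coord_creation_op creation_fun_def split: list.splits)
  also have "\<dots> = (\<Sum>\<^sub>\<infinity>w. of_real r * (coord x w * cnj (coord e w)))"
    by (subst infsum_reindex)
      (auto simp: o_def coord_creation_op creation_fun_def assms mult_ac intro!: inj_onI)
  also have "\<dots> = of_real r * cinner x e"
    by (simp add: cinner_def infsum_cmult_right')
  finally show ?thesis .
qed

lemma cinner_power_eigenvector:
  assumes "\<And>w. coord e (j # w) = of_real r * coord e w"
  shows "cinner (word_op (replicate k j) x) e = of_real (r ^ k) * cinner x e"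
  by (induction k) (simp_all add: cinner_creation_op_eigenvector[OF assms])

text \<open>
  The eigenvector is the geometric sequence \<open>r\<^sup>k\<close> placed on the words \<open>z\<^sub>j\<^sup>k\<close>.
\<close>

lemma geometric_vector:
  fixes j :: 'n and r :: real
  assumes "0 \<le> r" "r < 1"
  obtains e where "e \<noteq> 0" and "\<And>w. coord e (j # w) = of_real r * coord e w"
proof -
  define f :: "'n list \<Rightarrow> complex"
    where "f w = (if w = replicate (length w) j then of_real (r ^ length w) else 0)" for w
  have "summable (\<lambda>k. (r\<^sup>2) ^ k)"
    using assms by (intro summable_geometric) (simp add: power_less_one_iff abs_square_less_1)
  then have "(\<lambda>k. (r\<^sup>2) ^ k) summable_on UNIV"
    by (subst summable_on_UNIV_nonneg_real_iff) auto
  then have "((\<lambda>w. (cmod (f w))\<^sup>2) \<circ> (\<lambda>k. replicate k j)) summable_on UNIV"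
    using assms by (simp add: o_def f_def norm_power power_mult[symmetric] mult.commute)
  then have "(\<lambda>w. (cmod (f w))\<^sup>2) summable_on range (\<lambda>k. replicate k j)"
    by (subst summable_on_reindex) (auto intro!: inj_onI dest: arg_cong[of _ _ length])
  then have "(\<lambda>w. (cmod (f w))\<^sup>2) summable_on UNIV"
    by (rule summable_on_cong_neutral[THEN iffD1, rotated -1]) (auto simp: f_def)
  then have e: "coord (Abs_ell2 f) = f"
    by (rule coord_Abs_ell2)
  have "coord (Abs_ell2 f) [] \<noteq> 0"
    unfolding e by (simp add: f_def)
  then have "Abs_ell2 f \<noteq> 0"
    by (metis coord_zero)
  then show thesis
    by (rule that) (simp add: e f_def)
qed

section \<open>Fractional powers of one minus the variable\<close>

text \<open>The coefficients of the power series of \<open>(1 - z)\<^sup>\<alpha>\<close>.\<close>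

definition binom_coeff :: "real \<Rightarrow> nat \<Rightarrow> real" where
  "binom_coeff \<alpha> k = (-1) ^ k * (\<alpha> gchoose k)"

lemma binom_coeff_sums: "\<bar>r\<bar> < 1 \<Longrightarrow> (\<lambda>k. binom_coeff \<alpha> k * r ^ k) sums (1 - r) powr \<alpha>"
  using gen_binomial_real[of "-r" \<alpha>] by (simp add: binom_coeff_def power_minus[of r] mult_ac)

lemma binom_coeff_convolution:
  "(\<Sum>k\<le>n. binom_coeff \<alpha> k * binom_coeff \<beta> (n - k)) = binom_coeff (\<alpha> + \<beta>) n"
proof -
  have "binom_coeff \<alpha> k * binom_coeff \<beta> (n - k) = (-1) ^ n * ((\<alpha> gchoose k) * (\<beta> gchoose (n - k)))"
    if "k \<le> n" for k
  proof -
    have "(-1 :: real) ^ n = (-1) ^ k * (-1) ^ (n - k)"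
      using that by (simp flip: power_add)
    then show ?thesis by (simp add: binom_coeff_def)
  qed
  then have "(\<Sum>k\<le>n. binom_coeff \<alpha> k * binom_coeff \<beta> (n - k))
      = (-1) ^ n * (\<Sum>k\<le>n. (\<alpha> gchoose k) * (\<beta> gchoose (n - k)))"
    unfolding sum_distrib_left by (intro sum.cong) auto
  then show ?thesis
    by (simp add: binom_coeff_def gbinomial_Vandermonde[symmetric] atMost_atLeast0)
qed

text \<open>
  This growth rate is a form of Euler's limit formula for the Gamma function. It settles both the
  absolute summability for positive exponents and the square summability for exponents above
  \<open>- 1 / 2\<close>.
\<close>

lemma binom_coeff_bigo: "binom_coeff \<alpha> \<in> O(\<lambda>n. real n powr - (\<alpha> + 1))"
proof (rule bigoI_tendsto)
  have "(\<lambda>n. (\<alpha> gchoose n) / ((-1) ^ n / exp ((\<alpha> + 1) * of_real (ln (real n)))))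
      \<longlonglongrightarrow> inverse (Gamma (- \<alpha>))"
    by (rule gbinomial_asymptotic)
  then show "(\<lambda>n. binom_coeff \<alpha> n / real n powr - (\<alpha> + 1)) \<longlonglongrightarrow> inverse (Gamma (- \<alpha>))"
  proof (rule Lim_transform_eventually)
    show "\<forall>\<^sub>F n in sequentially. (\<alpha> gchoose n) / ((-1) ^ n / exp ((\<alpha> + 1) * of_real (ln (real n))))
        = binom_coeff \<alpha> n / real n powr - (\<alpha> + 1)"
      using eventually_gt_at_top[of 0]
    proof eventually_elim
      case (elim n)
      have "real n powr - (\<alpha> + 1) = inverse (exp ((\<alpha> + 1) * ln (real n)))"
        using elim by (subst powr_minus) (simp add: powr_def)
      then show ?case
        by (cases "even n") (simp_all add: binom_coeff_def divide_inverse)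
    qed
  qed
qed (auto intro: eventually_mono[OF eventually_gt_at_top[of 0]])

lemma summable_abs_binom_coeff:
  assumes "0 < \<alpha>"
  shows "summable (\<lambda>k. \<bar>binom_coeff \<alpha> k\<bar>)"
proof (rule summable_comparison_test_bigo)
  show "summable (\<lambda>n. norm (real n powr - (\<alpha> + 1)))"
    using assms by (simp add: summable_real_powr_iff)
qed (use binom_coeff_bigo in simp)

lemma summable_square_binom_coeff:
  assumes "- 1 / 2 < \<alpha>"
  shows "summable (\<lambda>k. (binom_coeff \<alpha> k)\<^sup>2)"
proof (rule summable_comparison_test_bigo)
  show "(\<lambda>k. (binom_coeff \<alpha> k)\<^sup>2) \<in> O(\<lambda>n. real n powr - (2 * (\<alpha> + 1)))"
    using landau_o.big_power[OF binom_coeff_bigo[of \<alpha>], of 2]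
    by (simp add: power2_eq_square flip: powr_add)
  show "summable (\<lambda>n. norm (real n powr - (2 * (\<alpha> + 1))))"
    using assms by (simp add: summable_real_powr_iff)
qed

text \<open>
  The vanishing of \<open>g\<close> cuts the square of indices down to the triangle \<open>k + m < N\<close>, on which the terms
  can be grouped by \<open>s = k + m\<close>.
\<close>

lemma truncated_convolution:
  fixes a b g :: "nat \<Rightarrow> 'a::comm_semiring_0"
  assumes "\<And>s. N \<le> s \<Longrightarrow> g s = 0"
  shows "(\<Sum>k<N. \<Sum>m<N. b k * a m * g (k + m)) = (\<Sum>s<N. (\<Sum>k\<le>s. b k * a (s - k)) * g s)"
proof -
  have below: "k + m < N" if "b k * a m * g (k + m) \<noteq> 0" for k m
    using assms[of "k + m"] that by (auto intro: leI ccontr)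
  have "(\<Sum>k<N. \<Sum>m<N. b k * a m * g (k + m))
      = (\<Sum>(k, m)\<in>{..<N} \<times> {..<N}. b k * a m * g (k + m))"
    by (simp add: sum.cartesian_product)
  also have "\<dots> = (\<Sum>(k, m)\<in>{(k, m). k + m < N}. b k * a m * g (k + m))"
    by (intro sum.mono_neutral_right) (auto intro: below)
  also have "\<dots> = (\<Sum>s<N. \<Sum>k\<le>s. b k * a (s - k) * g (k + (s - k)))"
    by (rule sum.triangle_reindex)
  also have "\<dots> = (\<Sum>s<N. (\<Sum>k\<le>s. b k * a (s - k)) * g s)"
    by (simp add: sum_distrib_right)
  finally show ?thesis .
qed

section \<open>The two factors\<close>

text \<open>
  This operator is the fractional power \<open>(1 - L\<^sub>j)\<^sup>\<alpha>\<close>. Evaluating its series on the geometric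
  eigenvectors of the adjoint of \<open>L\<^sub>j\<close> produces the eigenvalues \<open>(1 - r)\<^sup>\<alpha>\<close>, which approach \<open>0\<close>.
\<close>

lemma fractional_power_operator:
  fixes j :: "'n::finite"
  assumes "0 < \<alpha>"
  obtains B where "B \<in> toeplitz_algebra" and "\<not> invertible_op B"
    and "\<And>x w N. length w < N \<Longrightarrow> coord (blinfun_apply B x) w
      = (\<Sum>k<N. of_real (binom_coeff \<alpha> k) * coord (word_op (replicate k j) x) w)"
proof -
  define p where "p N = (\<Sum>k<N. binom_coeff \<alpha> k *\<^sub>R word_op (replicate k j))" for N
  have bound: "norm (p N) \<le> (\<Sum>k. \<bar>binom_coeff \<alpha> k\<bar>)" for N
    unfolding p_def
    by (rule order_trans[OF norm_word_sum_le_l1 sum_le_suminf])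
      (auto simp: assms summable_abs_binom_coeff)
  obtain B where B: "B \<in> toeplitz_algebra"
    and coord_B: "\<And>x w N. length w < N \<Longrightarrow> coord (blinfun_apply B x) w
      = (\<Sum>k<N. of_real (binom_coeff \<alpha> k) * coord (word_op (replicate k j) x) w)"
    and weak: "\<And>x y. (\<lambda>N. cinner (p N x) y) \<longlonglongrightarrow> cinner (blinfun_apply B x) y"
    unfolding p_def
    by (rule word_series[of "binom_coeff \<alpha>" "\<lambda>k. replicate k j", OF bound[unfolded p_def]]) auto
  have "\<not> invertible_op B"
  proof (rule not_invertible_of_adjoint_eigenvectors)
    fix \<epsilon> :: real
    assume "0 < \<epsilon>"
    \<comment> \<open>The eigenvalue at \<open>r = 1 - d\<close> is \<open>d\<close> to the power \<open>\<alpha>\<close>, which this choice makes at most \<open>\<epsilon> / 2\<close>.\<close>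
    define t where "t = min \<epsilon> 1 / 2"
    define d where "d = t powr (1 / \<alpha>)"
    have t: "0 < t" "t < 1" "t < \<epsilon>"
      using \<open>0 < \<epsilon>\<close> by (auto simp: t_def)
    have d: "0 < d" "d \<le> 1" "d powr \<alpha> = t"
      using t assms by (auto simp: d_def powr_powr intro!: powr_le1)
    obtain e where e: "e \<noteq> 0" "\<And>w. coord e (j # w) = of_real (1 - d) * coord e w"
      using geometric_vector[of "1 - d" j] d by auto
    have "cinner (B x) e = of_real t * cinner x e" for x
    proof (rule LIMSEQ_unique[OF weak])
      have "cinner (p N x) e = of_real (\<Sum>k<N. binom_coeff \<alpha> k * (1 - d) ^ k) * cinner x e" for N
        unfolding p_def
      proof (induction N)
        case (Suc N)
        then show ?case
          by (simp add: blinfun.add_left blinfun.scaleR_left cinner_add_left scaleR_ell2_def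
              cinner_scaleC_left cinner_power_eigenvector[OF e(2)] distrib_right)
      qed (simp add: cinner_def)
      moreover have "(\<lambda>N. \<Sum>k<N. binom_coeff \<alpha> k * (1 - d) ^ k) \<longlonglongrightarrow> t"
        using binom_coeff_sums[of "1 - d" \<alpha>] d by (simp add: sums_def)
      ultimately show "(\<lambda>N. cinner (p N x) e) \<longlonglongrightarrow> of_real t * cinner x e"
        by (simp add: tendsto_mult_right tendsto_of_real del: of_real_sum)
    qed
    then show "\<exists>e \<mu>. e \<noteq> 0 \<and> cmod \<mu> < \<epsilon> \<and> (\<forall>x. cinner (B x) e = \<mu> * cinner x e)"
      using e(1) t by (intro exI[of _ e] exI[of _ "of_real t"]) simp
  qed
  then show thesis
    using B coord_B by (intro that[of B])
qed

text \<open>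
  The words \<open>z\<^sub>j\<^sup>k z\<^sub>i\<close> are pairwise prefix-incomparable because the first occurrence of \<open>z\<^sub>i\<close> marks
  where \<open>z\<^sub>j\<^sup>k\<close> ends.
\<close>

lemma square_summable_series_operator:
  fixes i j :: "'n::finite" and a :: "nat \<Rightarrow> real"
  assumes "j \<noteq> i" and "summable (\<lambda>k. (a k)\<^sup>2)"
  obtains C where "C \<in> toeplitz_algebra"
    and "\<And>x w N. length w < N \<Longrightarrow> coord (blinfun_apply C x) w
      = (\<Sum>k<N. of_real (a k) * coord (word_op (replicate k j @ [i]) x) w)"
proof -
  define v where "v k = replicate k j @ [i]" for k
  have incomparable: "take (length (v k)) (v m) \<noteq> v k" if "k \<noteq> m" for k m
  proof
    assume eq: "take (length (v k)) (v m) = v k"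
    then have "k \<le> m"
      by (auto simp: v_def dest: arg_cong[of _ _ length])
    then have "v m ! k = j" "v k ! k = i"
      using that by (simp_all add: v_def nth_append)
    moreover have "take (length (v k)) (v m) ! k = v m ! k"
      by (rule nth_take) (simp add: v_def)
    then have "v k ! k = v m ! k"
      by (simp only: eq)
    ultimately show False using assms(1) by simp
  qed
  have bound: "norm (\<Sum>k<N. a k *\<^sub>R word_op (v k)) \<le> sqrt (\<Sum>k. (a k)\<^sup>2)" for N
  proof (rule order_trans[OF norm_word_sum_le_l2])
    show "sqrt (\<Sum>k<N. (a k)\<^sup>2) \<le> sqrt (\<Sum>k. (a k)\<^sup>2)"
      using assms(2) by (intro real_sqrt_le_mono sum_le_suminf) auto
  qed (simp_all add: incomparable)
  have len: "k \<le> length (v k)" for k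
    by (simp add: v_def)
  show thesis
    by (rule word_series[OF bound len]) (rule that; simp add: v_def)
qed

theorem corollary2p8:
  fixes i :: "'n::finite"
  assumes "CARD('n) \<ge> 2"
  shows "\<exists>B C. proper_factorization (creation_op i) B C"
proof -
  have "\<exists>j. j \<noteq> i"
  proof (rule ccontr)
    assume "\<nexists>j. j \<noteq> i"
    then have "UNIV = {i}" by auto
    then have "CARD('n) = card {i}" by (rule arg_cong)
    then show False using assms by simp
  qed
  then obtain j where j: "j \<noteq> i" ..
  \<comment> \<open>Any exponent strictly between \<open>0\<close> and \<open>1 / 2\<close> would do.\<close>
  define b where "b = binom_coeff (1 / 4)"
  define a where "a = binom_coeff (- 1 / 4)"
  obtain B where B: "B \<in> toeplitz_algebra" "\<not> invertible_op B"
    and coord_B: "\<And>x w N. length w < N \<Longrightarrow> coord (blinfun_apply B x) w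
      = (\<Sum>k<N. of_real (b k) * coord (word_op (replicate k j) x) w)"
    unfolding b_def by (rule fractional_power_operator[of "1 / 4" j]) auto
  have "summable (\<lambda>k. (a k)\<^sup>2)"
    by (simp add: a_def summable_square_binom_coeff)
  from square_summable_series_operator[OF j this]
  obtain C where C: "C \<in> toeplitz_algebra"
    and coord_C: "\<And>x w N. length w < N \<Longrightarrow> coord (blinfun_apply C x) w
      = (\<Sum>k<N. of_real (a k) * coord (word_op (replicate k j @ [i]) x) w)"
    by blast
  have "coord (B (C x)) w = coord (creation_op i x) w" for x w
  proof -
    define N where "N = Suc (length w)"
    have N: "length w < N" by (simp add: N_def)
    define g where "g s = coord (word_op (replicate s j @ [i]) x) w" for s
    have shift: "coord (word_op (replicate k j) (C x)) w = (\<Sum>m<N. of_real (a m) * g (k + m))" for k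
    proof -
      have "coord (word_op (replicate k j) (C x)) w
          = (\<Sum>m<N. of_real (a m) * coord (word_op (replicate k j) (word_op (replicate m j @ [i]) x)) w)"
        by (simp add: coord_word_op[of "replicate k j"] coord_C[of _ N] N_def less_Suc_eq_le)
      then show ?thesis
        by (simp add: g_def replicate_add flip: word_op_append)
    qed
    \<comment> \<open>Since \<open>g s\<close> vanishes for \<open>s > length w\<close>, truncating both series at \<open>N\<close> loses nothing.\<close>
    have "coord (B (C x)) w = (\<Sum>k<N. \<Sum>m<N. of_real (b k) * of_real (a m) * g (k + m))"
      by (simp add: coord_B[OF N] shift sum_distrib_left mult.assoc)
    also have "\<dots> = (\<Sum>s<N. (\<Sum>k\<le>s. of_real (b k) * of_real (a (s - k))) * g s)"
      by (rule truncated_convolution) (auto simp: g_def N_def intro!: coord_word_op_short)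
    also have "\<dots> = (\<Sum>s<N. of_real (if s = 0 then 1 else 0) * g s)"
    proof -
      have "(\<Sum>k\<le>s. b k * a (s - k)) = (if s = 0 then 1 else 0)" for s
        by (simp add: a_def b_def binom_coeff_convolution)
          (simp add: binom_coeff_def gbinomial_0_left)
      then show ?thesis
        by (simp flip: of_real_mult of_real_sum)
    qed
    also have "\<dots> = (\<Sum>s<N. if s = 0 then g s else 0)"
      by (rule sum.cong) auto
    also have "\<dots> = coord (creation_op i x) w"
      by (simp add: N_def g_def)
    finally show ?thesis .
  qed
  then have factor: "creation_op i = B o\<^sub>L C"
    by (intro blinfun_eqI ell2_eqI) simp
  \<comment> \<open>The vacuum vector is not in the range of \<open>C\<close>.\<close>
  have "\<not> invertible_op C"
  proof
    assume "invertible_op C"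
    then obtain S where S: "C o\<^sub>L S = id_blinfun"
      unfolding invertible_op_def by blast
    then have "C (S (basis_vec [])) = basis_vec []"
      by (metis blinfun_apply_blinfun_compose blinfun_apply_id_blinfun id_apply)
    moreover have "coord (C (S (basis_vec []))) [] = 0"
      by (simp add: coord_C[of _ 1] coord_creation_op creation_fun_def)
    ultimately show False by simp
  qed
  then show ?thesis
    using B C factor unfolding proper_factorization_def by blast
qed

end
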